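(* For all nonnegative integers $n$ and $k$, $$ s(-n,k)=\frac{(-1)^k}{n!}\sum_{\substack{\rho\in\mathcal P\\ \ell(\rho)=k\\ \rho_1\le n}}\pi(\rho)^{-1}, $$ where the sum is over all linear partitions $\rho$ with exactly $k$ parts and with no part greater than $n$.
   Context: For a nonnegative integer $n$, $(y)_{-n}=\frac{1}{(y+1)(y+2)\cdots(y+n)}$ (with $(y)_0=1$), and the Stirling number of the first kind $s(-n,k)$ of degree $-n$ and order $k\ge 0$ is the coefficient of $y^k$ in the Taylor expansion of $(y)_{-n}$ at $y=0$. A linear partition is a nonincreasing infinite sequence $\rho=(\rho_i)_{i\ge1}$ of nonnegative integers that is eventually zero; $\mathcal P$ is the set of all linear partitions. The nonzero $\rho_i$ are the parts of $\rho$ (counted with multiplicity), $\ell(\rho)$ is the number of parts, and $\pi(\rho)$ is the product of the parts. The zero sequence is a linear partition with no parts, and the product of its parts is $1$. *)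

theory Defs
  imports "HOL-Complex_Analysis.Complex_Analysis"
begin

text \<open>\<open>neg_falling_factorial n y\<close> is \<open>(y)\<^sub>-\<^sub>n\<close>: the argument \<open>n\<close> is the absolute value of the degree.
  It is taken as a function of a complex variable so that the library's Taylor expansion
  \<open>fps_expansion\<close> applies.\<close>

definition neg_falling_factorial :: "nat \<Rightarrow> complex \<Rightarrow> complex" where
  "neg_falling_factorial n y = 1 / (\<Prod>i=1..n. (y + of_nat i))"

text \<open>\<open>neg_stirling1 n k\<close> is the Stirling number of the first kind \<open>s(-n, k)\<close> of degree \<open>-n\<close> and
  order \<open>k\<close>.\<close>

definition neg_stirling1 :: "nat \<Rightarrow> nat \<Rightarrow> complex" where
  "neg_stirling1 n k = fps_nth (fps_expansion (neg_falling_factorial n) 0) k"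

text \<open>The sequence \<open>(\<rho>\<^sub>i)\<close>, \<open>i \<ge> 1\<close>, is indexed from \<open>0\<close>: \<open>\<rho> i\<close> stands for \<open>\<rho>\<^sub>i\<^sub>+\<^sub>1\<close>,
  so \<open>\<rho> 0\<close> is the largest part (or \<open>0\<close> if there are no parts).\<close>

definition linear_partitions :: "(nat \<Rightarrow> nat) set" where
  "linear_partitions = {\<rho>. antimono \<rho> \<and> (\<forall>\<^sub>F i in sequentially. \<rho> i = 0)}"

definition num_parts :: "(nat \<Rightarrow> nat) \<Rightarrow> nat" where
  "num_parts \<rho> = card {i. \<rho> i \<noteq> 0}"

definition prod_parts :: "(nat \<Rightarrow> nat) \<Rightarrow> nat" where
  "prod_parts \<rho> = (\<Prod>i\<in>{i. \<rho> i \<noteq> 0}. \<rho> i)"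

lemma finite_support_linear_partition:
  assumes "\<rho> \<in> linear_partitions"
  shows "finite {i. \<rho> i \<noteq> 0}"
proof -
  have "\<forall>\<^sub>F i in sequentially. \<rho> i = 0"
    using assms unfolding linear_partitions_def by blast
  hence "\<exists>N. \<forall>i\<ge>N. \<rho> i = 0"
    by (rule eventually_sequentially[THEN iffD1])
  then obtain N where N: "\<forall>i\<ge>N. \<rho> i = 0" ..
  have "{i. \<rho> i \<noteq> 0} \<subseteq> {..<N}"
  proof
    fix i assume "i \<in> {i. \<rho> i \<noteq> 0}"
    hence "\<rho> i \<noteq> 0" by simp
    hence "\<not> N \<le> i" using N by meson
    thus "i \<in> {..<N}" by simp
  qed
  thus ?thesis by (rule finite_subset) simp
qed

lemma linear_partition_le:
  assumes "\<rho> \<in> linear_partitions" "a \<le> b"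
  shows "\<rho> b \<le> \<rho> a"
  using assms antimonoD[of \<rho> a b] by (simp add: linear_partitions_def)

lemma linear_partition_eq_0:
  assumes "\<rho> \<in> linear_partitions" "num_parts \<rho> \<le> i"
  shows "\<rho> i = 0"
proof (rule ccontr)
  assume i: "\<rho> i \<noteq> 0"
  have "{..i} \<subseteq> {j. \<rho> j \<noteq> 0}"
  proof
    fix j assume "j \<in> {..i}"
    hence "\<rho> i \<le> \<rho> j" by (intro linear_partition_le[OF assms(1)]) simp
    thus "j \<in> {j. \<rho> j \<noteq> 0}" using i by simp
  qed
  hence "card {..i} \<le> num_parts \<rho>" unfolding num_parts_def
    by (rule card_mono[OF finite_support_linear_partition[OF assms(1)]])
  thus False using assms(2) by simp
qed

lemma finite_bounded_linear_partitions:
  "finite {\<rho> \<in> linear_partitions. num_parts \<rho> = k \<and> \<rho> 0 \<le> n}" (is "finite ?A")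
proof (rule finite_subset)
  let ?B = "{\<rho>. \<forall>i. (i \<in> {..<k} \<longrightarrow> \<rho> i \<in> {..n}) \<and> (i \<notin> {..<k} \<longrightarrow> \<rho> i = 0)}"
  show "finite ?B" by (rule finite_set_of_finite_funs) auto
  show "?A \<subseteq> ?B"
  proof
    fix \<rho> assume \<rho>: "\<rho> \<in> ?A"
    have "\<rho> i \<le> n" for i
      using \<rho> linear_partition_le[of \<rho> 0 i] by simp
    moreover have "\<rho> i = 0" if "k \<le> i" for i
      using \<rho> linear_partition_eq_0[of \<rho> i] that by simp
    ultimately show "\<rho> \<in> ?B" by simp
  qed
qed

end

theory Submission
  imports Defs
begin

text \<open>
  Both sides satisfy the recurrence
  \<open>(n + 1) s(-(n+1), k+1) = s(-n, k+1) - s(-(n+1), k)\<close>: for the Taylor coefficients it comes from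
  \<open>(y)\<^bsub>-(n+1)\<^esub> (y + n + 1) = (y)\<^sub>-\<^sub>n\<close>, and for the sum over partitions from
  splitting according to whether the largest part equals \<open>n + 1\<close>, in which case it is removed.
\<close>

definition bounded_partitions :: "nat \<Rightarrow> nat \<Rightarrow> (nat \<Rightarrow> nat) set" where
  "bounded_partitions n k = {\<rho> \<in> linear_partitions. num_parts \<rho> = k \<and> \<rho> 0 \<le> n}"

definition inverse_prod_sum :: "nat \<Rightarrow> nat \<Rightarrow> complex" where
  "inverse_prod_sum n k = (\<Sum>\<rho>\<in>bounded_partitions n k. inverse (of_nat (prod_parts \<rho>)))"

lemma finite_bounded_partitions: "finite (bounded_partitions n k)"
  unfolding bounded_partitions_def by (rule finite_bounded_linear_partitions)

lemma zero_in_linear_partitions: "(\<lambda>_. 0) \<in> linear_partitions"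
  by (simp add: linear_partitions_def monotone_def)

lemma linear_partition_first_0:
  assumes "\<rho> \<in> linear_partitions" "\<rho> 0 = 0"
  shows "\<rho> = (\<lambda>_. 0)"
  using linear_partition_le[OF assms(1), of 0] assms(2) by fastforce

lemma bounded_partitions_no_parts: "bounded_partitions n 0 = {\<lambda>_. 0}"
proof -
  have "\<rho> = (\<lambda>_. 0)" if "\<rho> \<in> linear_partitions" "num_parts \<rho> = 0" for \<rho>
    using linear_partition_eq_0[OF that(1)] that(2) by auto
  then show ?thesis
    by (auto simp: bounded_partitions_def zero_in_linear_partitions num_parts_def)
qed

lemma bounded_partitions_0: "bounded_partitions 0 (Suc k) = {}"
  by (auto simp: bounded_partitions_def num_parts_def dest: linear_partition_first_0)

lemma inverse_prod_sum_no_parts: "inverse_prod_sum n 0 = 1"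
  by (simp add: inverse_prod_sum_def bounded_partitions_no_parts prod_parts_def)

lemma inverse_prod_sum_0: "inverse_prod_sum 0 (Suc k) = 0"
  by (simp add: inverse_prod_sum_def bounded_partitions_0)

text \<open>\<open>case_nat m \<rho>\<close> prepends \<open>m\<close> to \<open>\<rho>\<close>, so
  old indices move up by one; \<open>m > 0\<close> makes index \<open>0\<close> part of the support.
  This is the inverse of removing a largest part.\<close>

lemma case_nat_support:
  assumes "m > 0"
  shows "{i. case_nat m \<rho> i \<noteq> (0::nat)} = insert 0 (Suc ` {i. \<rho> i \<noteq> 0})"
proof (rule set_eqI)
  show "i \<in> {i. case_nat m \<rho> i \<noteq> 0} \<longleftrightarrow> i \<in> insert 0 (Suc ` {i. \<rho> i \<noteq> 0})" for i
    using assms by (cases i) auto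
qed

lemma num_parts_case_nat:
  assumes "\<rho> \<in> linear_partitions" "m > 0"
  shows "num_parts (case_nat m \<rho>) = Suc (num_parts \<rho>)"
  using finite_support_linear_partition[OF assms(1)]
  unfolding num_parts_def case_nat_support[OF assms(2)]
  by (simp add: card_image)

lemma prod_parts_case_nat:
  assumes "\<rho> \<in> linear_partitions" "m > 0"
  shows "prod_parts (case_nat m \<rho>) = m * prod_parts \<rho>"
  using finite_support_linear_partition[OF assms(1)]
  unfolding prod_parts_def case_nat_support[OF assms(2)]
  by (simp add: prod.reindex)

text \<open>Monotonicity need only be checked on neighbouring entries, and the only new pair is
  \<open>m\<close>, \<open>\<rho> 0\<close>. A shift by one does not affect being eventually
  zero.\<close>

lemma linear_partitions_case_nat_iff:
  "case_nat m \<rho> \<in> linear_partitions \<longleftrightarrow> \<rho> \<in> linear_partitions \<and> \<rho> 0 \<le> m"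
proof -
  have "antimono (case_nat m \<rho>) \<longleftrightarrow> antimono \<rho> \<and> \<rho> 0 \<le> m"
    by (auto simp: decseq_Suc_iff split: nat.splits)
  moreover have "(\<forall>\<^sub>F i in sequentially. case_nat m \<rho> i = 0) \<longleftrightarrow> (\<forall>\<^sub>F i in sequentially. \<rho> i = 0)"
    using eventually_sequentially_Suc[of "\<lambda>i. case_nat m \<rho> i = 0"] by simp
  ultimately show ?thesis
    by (auto simp: linear_partitions_def)
qed

text \<open>After one part \<open>Suc n\<close> is removed, the bound on the rest stays
  \<open>Suc n\<close>, since the largest part may be repeated; only the number of parts
  drops.\<close>

lemma bounded_partitions_Suc:
  "bounded_partitions (Suc n) (Suc k) =
     bounded_partitions n (Suc k) \<union> case_nat (Suc n) ` bounded_partitions (Suc n) k"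
proof (intro equalityI subsetI)
  fix \<rho> assume \<rho>: "\<rho> \<in> bounded_partitions (Suc n) (Suc k)"
  show "\<rho> \<in> bounded_partitions n (Suc k) \<union> case_nat (Suc n) ` bounded_partitions (Suc n) k"
  proof (cases "\<rho> 0 = Suc n")
    case False
    with \<rho> show ?thesis by (auto simp: bounded_partitions_def)
  next
    case True
    define \<sigma> where "\<sigma> = (\<lambda>i. \<rho> (Suc i))"
    have eq: "\<rho> = case_nat (Suc n) \<sigma>"
      using True by (auto simp: \<sigma>_def split: nat.splits)
    have "case_nat (Suc n) \<sigma> \<in> linear_partitions"
      using \<rho> unfolding bounded_partitions_def eq by blast
    then have \<sigma>: "\<sigma> \<in> linear_partitions" "\<sigma> 0 \<le> Suc n"
      by (simp_all add: linear_partitions_case_nat_iff)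
    moreover have "Suc (num_parts \<sigma>) = Suc k"
      using \<rho> num_parts_case_nat[OF \<sigma>(1), of "Suc n"] unfolding bounded_partitions_def eq by simp
    ultimately have "\<sigma> \<in> bounded_partitions (Suc n) k"
      by (simp add: bounded_partitions_def)
    then show ?thesis using eq by blast
  qed
next
  fix \<rho> assume "\<rho> \<in> bounded_partitions n (Suc k) \<union> case_nat (Suc n) ` bounded_partitions (Suc n) k"
  then show "\<rho> \<in> bounded_partitions (Suc n) (Suc k)"
    by (auto simp: bounded_partitions_def num_parts_case_nat linear_partitions_case_nat_iff)
qed

lemma inverse_prod_sum_Suc:
  "inverse_prod_sum (Suc n) (Suc k) =
     inverse_prod_sum n (Suc k) + inverse_prod_sum (Suc n) k / of_nat (Suc n)"
proof -
  let ?w = "\<lambda>\<rho>. inverse (of_nat (prod_parts \<rho>)) :: complex"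
  \<comment> \<open>The first entry is at most \<open>n\<close> on the left and equal to
    \<open>Suc n\<close> on the right.\<close>
  have disj: "bounded_partitions n (Suc k) \<inter> case_nat (Suc n) ` bounded_partitions (Suc n) k = {}"
    by (auto simp: bounded_partitions_def)
  have inj: "inj_on (case_nat (Suc n)) (bounded_partitions (Suc n) k)"
    by (rule inj_onI) (metis nat.case(2) ext)
  have "sum ?w (case_nat (Suc n) ` bounded_partitions (Suc n) k) =
          (\<Sum>\<rho>\<in>bounded_partitions (Suc n) k. ?w (case_nat (Suc n) \<rho>))"
    by (simp add: sum.reindex[OF inj])
  also have "\<dots> = (\<Sum>\<rho>\<in>bounded_partitions (Suc n) k. ?w \<rho> / of_nat (Suc n))"
    by (rule sum.cong)
      (auto simp: bounded_partitions_def prod_parts_case_nat divide_inverse simp del: of_nat_Suc mult_Suc)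
  finally show ?thesis
    unfolding inverse_prod_sum_def bounded_partitions_Suc
    by (simp add: sum.union_disjoint finite_bounded_partitions disj sum_divide_distrib)
qed

text \<open>Moves from the analytic Taylor expansion to algebra of formal power series. The
  reciprocal exists because the constant coefficient of the product is \<open>n!\<close>, which is
  nonzero.\<close>

lemma neg_stirling1_fps:
  "neg_stirling1 n k = fps_nth (inverse (\<Prod>i=1..n. fps_X + of_nat i)) k"
proof -
  have "(\<lambda>y. \<Prod>i=1..n. y + of_nat i :: complex) has_fps_expansion (\<Prod>i=1..n. fps_X + of_nat i)"
    \<comment> \<open>Numerals in the series become \<open>fps_const\<close> terms, to which the
      expansion rule for constants applies.\<close>
    unfolding fps_of_nat[symmetric] by (intro fps_expansion_intros)
  moreover have "fps_nth (\<Prod>i=1..n. fps_X + of_nat i :: complex fps) 0 \<noteq> 0"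
    by (induction n) (simp_all del: of_nat_Suc)
  ultimately have "neg_falling_factorial n has_fps_expansion inverse (\<Prod>i=1..n. fps_X + of_nat i)"
    unfolding neg_falling_factorial_def
    by (auto simp: divide_inverse intro!: has_fps_expansion_inverse)
  then show ?thesis
    unfolding neg_stirling1_def using fps_expansion_eqI by metis
qed

text \<open>The last factor is a unit, as its constant coefficient \<open>Suc n\<close> is nonzero,
  and so it cancels.\<close>

lemma inverse_prod_fps_Suc:
  "inverse (\<Prod>i=1..Suc n. fps_X + of_nat i :: complex fps) * (fps_X + of_nat (Suc n)) =
     inverse (\<Prod>i=1..n. fps_X + of_nat i)"
proof -
  have "inverse (fps_X + of_nat (Suc n) :: complex fps) * (fps_X + of_nat (Suc n)) = 1"
    by (rule inverse_mult_eq_1) (simp del: of_nat_Suc)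
  then show ?thesis
    by (simp add: fps_inverse_mult mult.assoc del: of_nat_Suc)
qed

lemma neg_stirling1_Suc_0:
  "of_nat (Suc n) * neg_stirling1 (Suc n) 0 = neg_stirling1 n 0"
  using arg_cong[OF inverse_prod_fps_Suc[of n], of "\<lambda>F. fps_nth F 0"]
  by (simp add: neg_stirling1_fps mult.commute del: of_nat_Suc)

lemma neg_stirling1_Suc_Suc:
  "of_nat (Suc n) * neg_stirling1 (Suc n) (Suc k) = neg_stirling1 n (Suc k) - neg_stirling1 (Suc n) k"
proof -
  let ?F = "inverse (\<Prod>i=1..Suc n. fps_X + of_nat i :: complex fps)"
  \<comment> \<open>Multiplying by \<open>fps_X\<close> shifts the coefficients, which gives the
    term at \<open>k\<close>; the \<open>fps_const\<close> term only scales.\<close>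
  have "fps_nth (?F * (fps_X + fps_const (of_nat (Suc n)))) (Suc k) =
          fps_nth ?F k + fps_nth ?F (Suc k) * of_nat (Suc n)"
    by (simp add: distrib_left del: of_nat_Suc)
  then have "neg_stirling1 n (Suc k) =
          neg_stirling1 (Suc n) k + neg_stirling1 (Suc n) (Suc k) * of_nat (Suc n)"
    unfolding neg_stirling1_fps fps_of_nat inverse_prod_fps_Suc by simp
  then show ?thesis by (simp add: mult.commute)
qed

text \<open>The recurrence expresses the value at \<open>(Suc n, Suc k)\<close> by those at
  \<open>(n, Suc k)\<close> and \<open>(Suc n, k)\<close>, hence an induction on \<open>k\<close>
  inside one on \<open>n\<close>. Each step is proved after multiplication by
  \<open>Suc n\<close>.\<close>

lemma neg_stirling1_eq_inverse_prod_sum: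
  "neg_stirling1 n k = (-1) ^ k / fact n * inverse_prod_sum n k"
proof (induction n arbitrary: k)
  case 0
  show ?case
    by (cases k) (simp_all add: neg_stirling1_fps inverse_prod_sum_no_parts inverse_prod_sum_0)
next
  case (Suc n)
  note IH = Suc.IH
  have nz: "(of_nat (Suc n) :: complex) \<noteq> 0" by (simp del: of_nat_Suc)
  show ?case
  proof (induction k)
    case 0
    have "of_nat (Suc n) * neg_stirling1 (Suc n) 0 =
            of_nat (Suc n) * ((-1) ^ 0 / fact (Suc n) * inverse_prod_sum (Suc n) 0)"
      unfolding neg_stirling1_Suc_0 IH inverse_prod_sum_no_parts
      using nz by (simp add: field_simps del: of_nat_Suc)
    then show ?case unfolding mult_left_cancel[OF nz] .
  next
    case (Suc k)
    have "of_nat (Suc n) * neg_stirling1 (Suc n) (Suc k) =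
            of_nat (Suc n) * ((-1) ^ Suc k / fact (Suc n) * inverse_prod_sum (Suc n) (Suc k))"
      \<comment> \<open>\<open>IH\<close> is the outer hypothesis, used at \<open>Suc k\<close>;
        \<open>Suc.IH\<close> is now the inner one. The minus sign of the recurrence turns
        \<open>(-1) ^ k\<close> into \<open>(-1) ^ Suc k\<close>.\<close>
      unfolding neg_stirling1_Suc_Suc Suc.IH IH inverse_prod_sum_Suc
      using nz by (simp add: field_simps del: of_nat_Suc)
    then show ?case unfolding mult_left_cancel[OF nz] .
  qed
qed

theorem proposition2p1:
  fixes n k :: nat
  shows "neg_stirling1 n k =
    (-1) ^ k / fact n *
      (\<Sum>\<rho> \<in> {\<rho> \<in> linear_partitions. num_parts \<rho> = k \<and> \<rho> 0 \<le> n}. inverse (of_nat (prod_parts \<rho>)))"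
  using neg_stirling1_eq_inverse_prod_sum[of n k]
  unfolding inverse_prod_sum_def bounded_partitions_def .

end
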